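(* For every integer $n\ge 5$, $$\left\lfloor \frac{n-3}{2}\right\rfloor \leq c_2(n, C_5)\leq \left\lfloor \frac{n}{2}\right\rfloor.$$ In particular, $c_2(C_5)=\frac{1}{2}$.
   Context: A $3$-graph $G=(V,E)$ consists of a finite vertex set $V$ and a set $E$ of $3$-element subsets of $V$ (its edges). A copy of $F$ in $G$ is a (not necessarily induced) subgraph of $G$ isomorphic to $F$. The codegree $d(x,y)$ of a pair of distinct vertices is the number of edges containing both $x$ and $y$, and $\delta_2(G)$ is the minimum of $d(x,y)$ over all pairs of distinct vertices. $G$ has an $F$-covering if every vertex of $G$ lies in at least one copy of $F$ in $G$. For a $3$-graph $F$ with at least one edge and an integer $n\ge |V(F)|$, $$c_2(n,F)=\max\{\delta_2(G): |V(G)|=n \text{ and } G \text{ does not have an } F\text{-covering}\},$$ and $c_2(F)=\lim_{n\to\infty}\frac{c_2(n,F)}{n-2}$ (this limit exists). $C_5$ denotes the strong (tight) $5$-cycle: the $3$-graph on $\{1,2,3,4,5\}$ with edges $123, 234, 345, 451, 512$. *)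

theory Defs
  imports Complex_Main
begin

text \<open>A 3-graph is encoded as the pair of its vertex set and its edge set.\<close>

type_synonym 'a hypergraph = "'a set \<times> 'a set set"

abbreviation verts :: "'a hypergraph \<Rightarrow> 'a set" where
  "verts G \<equiv> fst G"

abbreviation edges :: "'a hypergraph \<Rightarrow> 'a set set" where
  "edges G \<equiv> snd G"

definition three_graph :: "'a hypergraph \<Rightarrow> bool" where
  "three_graph G \<longleftrightarrow> finite (verts G) \<and> (\<forall>e\<in>edges G. e \<subseteq> verts G \<and> card e = 3)"

definition subgraph :: "'a hypergraph \<Rightarrow> 'a hypergraph \<Rightarrow> bool" where
  "subgraph H G \<longleftrightarrow> three_graph H \<and> verts H \<subseteq> verts G \<and> edges H \<subseteq> edges G"

definition isomorphic :: "'a hypergraph \<Rightarrow> 'b hypergraph \<Rightarrow> bool" where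
  "isomorphic F H \<longleftrightarrow>
     (\<exists>f. bij_betw f (verts F) (verts H) \<and> edges H = (\<lambda>e. f ` e) ` edges F)"

definition is_copy :: "'b hypergraph \<Rightarrow> 'a hypergraph \<Rightarrow> 'a hypergraph \<Rightarrow> bool" where
  "is_copy F G H \<longleftrightarrow> subgraph H G \<and> isomorphic F H"

definition has_covering :: "'b hypergraph \<Rightarrow> 'a hypergraph \<Rightarrow> bool" where
  "has_covering F G \<longleftrightarrow> (\<forall>v\<in>verts G. \<exists>H. is_copy F G H \<and> v \<in> verts H)"

definition codegree :: "'a hypergraph \<Rightarrow> 'a \<Rightarrow> 'a \<Rightarrow> nat" where
  "codegree G x y = card {e \<in> edges G. x \<in> e \<and> y \<in> e}"

text \<open>Meaningful for 3-graphs with at least two vertices, so that the minimum is taken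
  over a nonempty finite set.\<close>

definition min_codegree :: "'a hypergraph \<Rightarrow> nat" where
  "min_codegree G = Min {codegree G x y | x y. x \<in> verts G \<and> y \<in> verts G \<and> x \<noteq> y}"

text \<open>Every finite 3-graph is isomorphic to one whose vertices are natural numbers, and the
  minimum codegree and the covering property are isomorphism invariant; so it is enough that
  \<open>G\<close> ranges over 3-graphs with vertices in \<^typ>\<open>nat\<close>. For \<open>F\<close> with at least one edge and
  \<open>n \<ge> card (verts F)\<close> the set below is nonempty (it contains the value of the edgeless
  3-graph) and bounded by \<open>n - 2\<close>, so the maximum exists.\<close>

definition c2 :: "nat \<Rightarrow> 'b hypergraph \<Rightarrow> nat" where
  "c2 n F = Max {min_codegree G | G :: nat hypergraph.
                   three_graph G \<and> card (verts G) = n \<and> \<not> has_covering F G}"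

definition c2_ratio :: "'b hypergraph \<Rightarrow> nat \<Rightarrow> real" where
  "c2_ratio F n = real (c2 n F) / (real n - 2)"

definition c2_lim :: "'b hypergraph \<Rightarrow> real" where
  "c2_lim F = lim (c2_ratio F)"

definition C5 :: "nat hypergraph" where
  "C5 = ({1, 2, 3, 4, 5}, {{1, 2, 3}, {2, 3, 4}, {3, 4, 5}, {4, 5, 1}, {5, 1, 2}})"

end

theory Submission
  imports Defs "HOL-Real_Asymp.Real_Asymp"
begin

text \<open>
  Fix a vertex \<open>v\<close> and let its link be the ordinary graph formed by the pairs \<open>xy\<close> for which
  \<open>vxy\<close> is an edge. A tight 5-cycle through \<open>v\<close> is the same as a
  path on four vertices in the link whose two end vertices form an edge with each of the
  two inner vertices (\<open>C5_cover_iff\<close>).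

  Upper bound. Let \<open>d\<close> be any vertex other than \<open>v\<close>, let \<open>S\<close> be the set of link-neighbours of
  \<open>d\<close>, and let \<open>\<Gamma>\<close> be the intersection of the links of \<open>v\<close> and \<open>d\<close>, a graph on the other
  \<open>n - 2\<close> vertices. If \<open>v\<close> lies in no 5-cycle, then walking from some \<open>c \<in> S\<close> to a
  \<open>\<Gamma>\<close>-neighbour \<open>a\<close> and on to a \<open>\<Gamma>\<close>-neighbour \<open>x \<noteq> c\<close> of \<open>a\<close> ends at a vertex joined to \<open>c\<close>
  in neither of the two links. When all codegrees exceed \<open>n / 2\<close>, inclusion-exclusion shows
  that at least two fewer vertices are joined to \<open>c\<close> in neither link than in both, so the \<open>\<Gamma>\<close>-degree of
  \<open>a\<close> is strictly smaller than that of \<open>c\<close>. A set \<open>S\<close> of non-isolated vertices from which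
  degrees strictly drop along every edge contains at most half of the vertices
  (\<open>card_le_half_if_degrees_drop\<close>), whereas \<open>S\<close> has more than \<open>n / 2\<close> of them.

  Lower bound. Split the vertices other than \<open>v\<close> into two nearly equal blocks. Take as edges
  the triples \<open>vxy\<close> with \<open>x\<close>, \<open>y\<close> in the same block, and the triples avoiding \<open>v\<close> that meet
  both blocks. A path in the link of \<open>v\<close> stays in one block, which spans no edge, so
  \<open>v\<close> is uncovered.
\<close>

section \<open>Codegrees as neighbourhood sizes\<close>

definition nbrs :: "'a hypergraph \<Rightarrow> 'a \<Rightarrow> 'a \<Rightarrow> 'a set" where
  "nbrs G x y = {z. {x, y, z} \<in> edges G}"

lemma edge_distinct:
  assumes "three_graph G" "{x, y, z} \<in> edges G"
  shows "x \<noteq> y" "x \<noteq> z" "y \<noteq> z" "x \<in> verts G" "y \<in> verts G" "z \<in> verts G"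
proof -
  have c: "card {x, y, z} = 3" and s: "{x, y, z} \<subseteq> verts G"
    using assms unfolding three_graph_def by auto
  show "x \<in> verts G" "y \<in> verts G" "z \<in> verts G" using s by auto
  show "x \<noteq> y" "x \<noteq> z" "y \<noteq> z" using c by (auto simp: card_insert_if split: if_splits)
qed

lemma nbrs_subset: "three_graph G \<Longrightarrow> nbrs G x y \<subseteq> verts G - {x, y}"
  using edge_distinct[of G x y] unfolding nbrs_def by blast

lemma finite_nbrs: "three_graph G \<Longrightarrow> finite (nbrs G x y)"
  by (meson finite_Diff finite_subset nbrs_subset three_graph_def)

lemma nbrs_commute: "nbrs G x y = nbrs G y x"
  unfolding nbrs_def by (simp add: insert_commute)

lemma codegree_eq_card_nbrs:
  assumes G: "three_graph G" and "x \<noteq> y"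
  shows "codegree G x y = card (nbrs G x y)"
proof -
  have "bij_betw (\<lambda>z. {x, y, z}) (nbrs G x y) {e \<in> edges G. x \<in> e \<and> y \<in> e}"
    unfolding bij_betw_def
  proof
    show "inj_on (\<lambda>z. {x, y, z}) (nbrs G x y)"
      using nbrs_subset[OF G, of x y] by (intro inj_onI) blast
    show "(\<lambda>z. {x, y, z}) ` nbrs G x y = {e \<in> edges G. x \<in> e \<and> y \<in> e}"
    proof (intro equalityI subsetI)
      fix e assume e: "e \<in> {e \<in> edges G. x \<in> e \<and> y \<in> e}"
      then have "card e = 3" using G by (auto simp: three_graph_def)
      moreover have "finite e" using \<open>card e = 3\<close> card.infinite by fastforce
      ultimately have "card (e - {x, y}) = 1"
        using e \<open>x \<noteq> y\<close> by (subst card_Diff_subset) auto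
      then obtain z where "e - {x, y} = {z}" using card_1_singletonE by blast
      then have "e = {x, y, z}" using e by blast
      then show "e \<in> (\<lambda>z. {x, y, z}) ` nbrs G x y" using e by (auto simp: nbrs_def)
    qed (auto simp: nbrs_def)
  qed
  then show ?thesis unfolding codegree_def by (simp add: bij_betw_same_card)
qed

lemma finite_codegrees:
  assumes "three_graph G"
  shows "finite {codegree G x y | x y. x \<in> verts G \<and> y \<in> verts G \<and> x \<noteq> y}"
proof -
  have "finite ((\<lambda>(x, y). codegree G x y) ` (verts G \<times> verts G))"
    using assms by (auto simp: three_graph_def)
  then show ?thesis by (rule rev_finite_subset) auto
qed

lemma min_codegree_le:
  "three_graph G \<Longrightarrow> x \<in> verts G \<Longrightarrow> y \<in> verts G \<Longrightarrow> x \<noteq> y \<Longrightarrow>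
     min_codegree G \<le> codegree G x y"
  unfolding min_codegree_def by (rule Min_le[OF finite_codegrees]) auto

lemma le_min_codegree:
  assumes "three_graph G" "2 \<le> card (verts G)"
    and "\<And>x y. x \<in> verts G \<Longrightarrow> y \<in> verts G \<Longrightarrow> x \<noteq> y \<Longrightarrow> k \<le> codegree G x y"
  shows "k \<le> min_codegree G"
proof -
  obtain x y where "x \<in> verts G" "y \<in> verts G" "x \<noteq> y"
    using assms(2) card_le_Suc0_iff_eq[of "verts G"] assms(1) three_graph_def
    by (metis One_nat_def Suc_1 not_less_eq_eq)
  then have "{codegree G x y | x y. x \<in> verts G \<and> y \<in> verts G \<and> x \<noteq> y} \<noteq> {}" by blast
  then show ?thesis
    unfolding min_codegree_def using finite_codegrees[OF assms(1)] assms(3)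
    by (subst Min_ge_iff) auto
qed

section \<open>Tight 5-cycles through a vertex\<close>

text \<open>By the rotational symmetry of the cycle \<open>v\<close> may be put in any of the five positions. When
  the cycle is \<open>v b a d c\<close> in cyclic order, its three edges at \<open>v\<close> form the path
  \<open>a - b - c - d\<close> in the link, and the other two are \<open>bad\<close> and \<open>adc\<close>. Conversely, such
  vertices are automatically distinct, since any two of them lie in one of the five edges.\<close>

lemma C5_cover_iff:
  assumes G: "three_graph G"
  shows "(\<exists>H. is_copy C5 G H \<and> v \<in> verts H) \<longleftrightarrow>
    (\<exists>a b c d. {v, a, b} \<in> edges G \<and> {v, b, c} \<in> edges G \<and> {v, c, d} \<in> edges G \<and>
               {d, a, b} \<in> edges G \<and> {d, a, c} \<in> edges G)" (is "?L \<longleftrightarrow> ?R")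
proof
  assume ?L
  then obtain H where H: "is_copy C5 G H" "v \<in> verts H" by blast
  then obtain f where f: "bij_betw f {1, 2, 3, 4, 5} (verts H)"
    and eH: "edges H = (\<lambda>e. f ` e) ` edges C5" and sub: "edges H \<subseteq> edges G"
    unfolding is_copy_def subgraph_def isomorphic_def by (auto simp: C5_def)
  have e: "{f 1, f 2, f 3} \<in> edges G" "{f 2, f 3, f 4} \<in> edges G" "{f 3, f 4, f 5} \<in> edges G"
    "{f 4, f 5, f 1} \<in> edges G" "{f 5, f 1, f 2} \<in> edges G"
    using sub eH by (auto simp: C5_def)
  have "v \<in> f ` {1, 2, 3, 4, 5}" using f H(2) by (auto simp: bij_betw_def)
  then consider "v = f 1" | "v = f 2" | "v = f 3" | "v = f 4" | "v = f 5" by auto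
  then show ?R
  proof cases
    case 1
    show ?thesis
      by (rule exI[of _ "f 3"], rule exI[of _ "f 2"], rule exI[of _ "f 5"], rule exI[of _ "f 4"])
        (use e 1 in \<open>simp add: insert_commute\<close>)
  next
    case 2
    show ?thesis
      by (rule exI[of _ "f 4"], rule exI[of _ "f 3"], rule exI[of _ "f 1"], rule exI[of _ "f 5"])
        (use e 2 in \<open>simp add: insert_commute\<close>)
  next
    case 3
    show ?thesis
      by (rule exI[of _ "f 5"], rule exI[of _ "f 4"], rule exI[of _ "f 2"], rule exI[of _ "f 1"])
        (use e 3 in \<open>simp add: insert_commute\<close>)
  next
    case 4
    show ?thesis
      by (rule exI[of _ "f 1"], rule exI[of _ "f 5"], rule exI[of _ "f 3"], rule exI[of _ "f 2"])
        (use e 4 in \<open>simp add: insert_commute\<close>)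
  next
    case 5
    show ?thesis
      by (rule exI[of _ "f 2"], rule exI[of _ "f 1"], rule exI[of _ "f 4"], rule exI[of _ "f 3"])
        (use e 5 in \<open>simp add: insert_commute\<close>)
  qed
next
  assume ?R
  then obtain a b c d where e: "{v, a, b} \<in> edges G" "{v, b, c} \<in> edges G"
    "{v, c, d} \<in> edges G" "{d, a, b} \<in> edges G" "{d, a, c} \<in> edges G" by blast
  note dist = e[THEN edge_distinct(1)[OF G]] e[THEN edge_distinct(2)[OF G]]
    e[THEN edge_distinct(3)[OF G]]
  define f :: "nat \<Rightarrow> 'a" where
    "f k = (if k = 1 then v else if k = 2 then b else if k = 3 then a
            else if k = 4 then d else c)" for k
  have f: "f 1 = v" "f 2 = b" "f 3 = a" "f 4 = d" "f 5 = c" by (simp_all add: f_def)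
  let ?H = "(f ` {1, 2, 3, 4, 5}, (\<lambda>e. f ` e) ` edges C5)"
  have edges_H: "(\<lambda>e. f ` e) ` edges C5 =
      {{v, b, a}, {b, a, d}, {a, d, c}, {d, c, v}, {c, v, b}}"
    unfolding C5_def snd_conv image_insert image_empty f ..
  have sub: "edges ?H \<subseteq> edges G"
    unfolding snd_conv edges_H using e by (simp add: insert_commute)
  have "bij_betw f (verts C5) (verts ?H)"
    using dist by (auto simp: bij_betw_def C5_def f[unfolded One_nat_def])
  then have "isomorphic C5 ?H" unfolding isomorphic_def by auto
  moreover have "verts ?H \<subseteq> verts G"
    using e[THEN edge_distinct(4)[OF G]] e[THEN edge_distinct(5)[OF G]]
      e[THEN edge_distinct(6)[OF G]] by (simp add: f[unfolded One_nat_def])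
  moreover have "three_graph ?H"
    unfolding three_graph_def
  proof (intro conjI ballI)
    fix e assume e: "e \<in> edges ?H"
    then show "card e = 3" using sub G by (auto simp: three_graph_def)
    show "e \<subseteq> verts ?H" using e by (auto simp: C5_def)
  qed simp
  ultimately have "is_copy C5 G ?H" using sub by (simp add: is_copy_def subgraph_def)
  moreover have "v \<in> verts ?H" by (simp add: f[unfolded One_nat_def])
  ultimately show ?L by blast
qed

section \<open>Degrees that drop along every edge\<close>

text \<open>Think of \<open>N\<close> as the neighbourhoods of a graph on \<open>W\<close>. Strictness makes \<open>S\<close> independent, as
  degrees cannot drop in both directions along an edge. Every \<open>c \<in> S\<close> spreads unit mass evenly
  over its neighbours, all in \<open>W - S\<close>; a neighbour \<open>r\<close> receives less than \<open>1 / card (N r)\<close> along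
  each of its edges, hence at most 1 in total. So \<open>card S \<le> card (W - S)\<close>.\<close>

lemma card_le_half_if_degrees_drop:
  fixes N :: "'a \<Rightarrow> 'a set"
  assumes fin: "finite W" and S: "S \<subseteq> W"
    and sub: "\<And>x. N x \<subseteq> W" and sym: "\<And>x y. y \<in> N x \<Longrightarrow> x \<in> N y"
    and nonempty: "\<And>c. c \<in> S \<Longrightarrow> N c \<noteq> {}"
    and drop: "\<And>c a. c \<in> S \<Longrightarrow> a \<in> N c \<Longrightarrow> card (N a) < card (N c)"
  shows "2 * card S \<le> card W"
proof -
  let ?w = "\<lambda>x. 1 / real (card (N x))"
  have finN: "finite (N x)" for x using sub fin finite_subset by blast
  have finS: "finite S" using S fin finite_subset by blast
  \<comment> \<open>\<open>S\<close> is independent; stated as a restricted comprehension to allow swapping the sums below.\<close>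
  have NS: "N c = {r \<in> W - S. r \<in> N c}" if "c \<in> S" for c
  proof -
    have "r \<in> W - S" if r: "r \<in> N c" for r
      using sub r drop[OF \<open>c \<in> S\<close> r] drop[OF _ sym[OF r]] less_asym by blast
    then show ?thesis by blast
  qed
  have "real (card S) = (\<Sum>c\<in>S. \<Sum>r\<in>N c. ?w c)"
    using nonempty finN by simp
  also have "\<dots> \<le> (\<Sum>c\<in>S. \<Sum>r\<in>N c. ?w r)"
  proof (intro sum_mono)
    fix c r assume c: "c \<in> S" and r: "r \<in> N c"
    have "0 < card (N r)" using sym[OF r] finN card_gt_0_iff by blast
    then show "?w c \<le> ?w r" using drop[OF c r] by (simp add: frac_le)
  qed
  also have "\<dots> = (\<Sum>c\<in>S. \<Sum>r\<in>{r \<in> W - S. r \<in> N c}. ?w r)"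
    using NS by (intro sum.cong) auto
  also have "\<dots> = (\<Sum>r\<in>W - S. \<Sum>c\<in>{c \<in> S. r \<in> N c}. ?w r)"
    using finS fin by (intro sum.swap_restrict) auto
  also have "\<dots> \<le> (\<Sum>r\<in>W - S. 1)"
  proof (intro sum_mono)
    fix r assume "r \<in> W - S"
    have "card {c \<in> S. r \<in> N c} \<le> card (N r)"
      using sym by (intro card_mono[OF finN]) auto
    then show "(\<Sum>c\<in>{c \<in> S. r \<in> N c}. ?w r) \<le> 1"
      by (cases "card (N r) = 0") (simp_all add: divide_le_eq_1)
  qed
  also have "\<dots> = real (card (W - S))" by simp
  finally have "card S \<le> card (W - S)" by simp
  then show ?thesis using S fin finS card_mono[OF fin S] by (simp add: card_Diff_subset)
qed

section \<open>The upper bound\<close>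

text \<open>Here \<open>N\<close> is the common part of the links of \<open>v\<close> and a second vertex \<open>d\<close>, and the degree drop is
  applied to the link-neighbours of \<open>d\<close>.\<close>

lemma C5_cover_if_large_codegree:
  assumes G: "three_graph G" and v: "v \<in> verts G" and n: "2 \<le> card (verts G)"
    and codeg: "\<And>x y. x \<in> verts G \<Longrightarrow> y \<in> verts G \<Longrightarrow> x \<noteq> y \<Longrightarrow>
      card (verts G) + 1 \<le> 2 * codegree G x y"
  shows "\<exists>H. is_copy C5 G H \<and> v \<in> verts H"
proof (rule ccontr)
  assume "\<not> ?thesis"
  then have no_path: False if "{v, a, b} \<in> edges G" "{v, b, c} \<in> edges G"
    "{v, c, d} \<in> edges G" "{d, a, b} \<in> edges G" "{d, a, c} \<in> edges G" for a b c d
    unfolding C5_cover_iff[OF G] using that by blast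
  have finV: "finite (verts G)" using G by (simp add: three_graph_def)
  have deg: "card (verts G) + 1 \<le> 2 * card (nbrs G x y)"
    if "x \<in> verts G" "y \<in> verts G" "x \<noteq> y" for x y
    using codeg[OF that] codegree_eq_card_nbrs[OF G that(3)] by simp
  obtain d where d: "d \<in> verts G" "d \<noteq> v"
    using n v card_le_Suc0_iff_eq[OF finV] by (metis One_nat_def Suc_1 not_less_eq_eq)
  define W where "W = verts G - {v, d}"
  define N where "N x = nbrs G v x \<inter> nbrs G d x" for x
  have cardW: "card W = card (verts G) - 2"
    unfolding W_def using v d finV by (subst card_Diff_subset) auto
  \<comment> \<open>Below \<open>A\<close> and \<open>B\<close> are the neighbours of \<open>c\<close> in the links of \<open>v\<close> and \<open>d\<close>. The set \<open>N c\<close> is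
    their intersection, and the neighbours of \<open>a\<close> other than \<open>c\<close> lie outside their union.\<close>
  have key: "card (N a) < card (N c)" if c: "c \<in> nbrs G v d" and a: "a \<in> N c" for c a
  proof -
    have cV: "c \<in> verts G" "c \<noteq> v" "c \<noteq> d" using c nbrs_subset[OF G, of v d] by auto
    define U where "U = verts G - {v, c, d}"
    define A where "A = nbrs G v c - {d}"
    define B where "B = nbrs G d c - {v}"
    have AU: "A \<subseteq> U" and BU: "B \<subseteq> U"
      using nbrs_subset[OF G, of v c] nbrs_subset[OF G, of d c] by (auto simp: A_def B_def U_def)
    have finU: "finite U" using finV by (simp add: U_def)
    have finAB: "finite A" "finite B" using AU BU finU finite_subset by blast+
    have cardU: "card U = card (verts G) - 3"
      unfolding U_def using v d cV finV by (subst card_Diff_subset) auto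
    have U3: "3 \<le> card (verts G)"
      using card_mono[OF finV, of "{v, c, d}"] v d cV by simp
    have dA: "card (nbrs G v c) \<le> card A + 1" and dB: "card (nbrs G d c) \<le> card B + 1"
      unfolding A_def B_def using diff_card_le_card_Diff[of "{d}" "nbrs G v c"] diff_card_le_card_Diff[of "{v}" "nbrs G d c"]
      by simp_all
    have "card A + card B = card (A \<union> B) + card (A \<inter> B)"
      using finAB by (rule card_Un_Int)
    moreover have NAB: "A \<inter> B = N c"
      using nbrs_subset[OF G, of d c] nbrs_subset[OF G, of v c]
      by (auto simp: A_def B_def N_def)
    moreover have "card (U - (A \<union> B)) = card U - card (A \<union> B)"
      using finAB AU BU by (intro card_Diff_subset) auto
    moreover have "card (A \<union> B) \<le> card U" using AU BU finU by (intro card_mono) auto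
    moreover note deg[OF v cV(1)] deg[OF d(1) cV(1)] cV dA dB cardU U3
    ultimately have Q: "card (U - (A \<union> B)) + 2 \<le> card (N c)" by auto
    have "N a \<subseteq> insert c (U - (A \<union> B))"
    proof
      fix x assume x: "x \<in> N a"
      have xe: "{v, a, x} \<in> edges G" "{d, a, x} \<in> edges G" using x by (auto simp: N_def nbrs_def)
      have ae: "{v, c, a} \<in> edges G" "{d, c, a} \<in> edges G" using a by (auto simp: N_def nbrs_def)
      have ce: "{v, d, c} \<in> edges G" using c by (auto simp: nbrs_def)
      \<comment> \<open>Otherwise the path \<open>a - x - c - d\<close> closes up with the edges \<open>axd\<close> and \<open>acd\<close>.\<close>
      have "x \<notin> A"
        using no_path[of a x c d] xe ae ce by (auto simp: A_def nbrs_def insert_commute)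
      \<comment> \<open>Otherwise the path \<open>x - a - c - d\<close> closes up with the edges \<open>xad\<close> and \<open>xcd\<close>.\<close>
      moreover have "x \<notin> B"
        using no_path[of x a c d] xe ae ce by (auto simp: B_def nbrs_def insert_commute)
      moreover have "x \<in> verts G" "x \<noteq> v" "x \<noteq> d"
        using edge_distinct[OF G xe(1)] edge_distinct[OF G xe(2)] by auto
      ultimately show "x \<in> insert c (U - (A \<union> B))" by (auto simp: U_def)
    qed
    then have "card (N a) \<le> card (insert c (U - (A \<union> B)))"
      using finU by (intro card_mono) auto
    also have "\<dots> \<le> card (U - (A \<union> B)) + 1" using finU by (simp add: card_insert_if)
    finally show ?thesis using Q by simp
  qed
  have nonempty: "N c \<noteq> {}" if c: "c \<in> nbrs G v d" for c
  proof -
    have cV: "c \<in> verts G" "c \<noteq> v" "c \<noteq> d" using c nbrs_subset[OF G, of v d] by auto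
    have "card (nbrs G v c \<union> nbrs G d c) \<le> card (verts G)"
      using nbrs_subset[OF G] by (intro card_mono[OF finV]) blast
    moreover have "card (nbrs G v c) + card (nbrs G d c)
        = card (nbrs G v c \<union> nbrs G d c) + card (N c)"
      unfolding N_def using finite_nbrs[OF G] by (intro card_Un_Int) auto
    ultimately have "0 < card (N c)"
      using deg[OF v cV(1)] deg[OF d(1) cV(1)] cV by auto
    then show ?thesis by auto
  qed
  have "2 * card (nbrs G v d) \<le> card W"
  proof (rule card_le_half_if_degrees_drop[of W _ N])
    show "finite W" using finV by (simp add: W_def)
    show "nbrs G v d \<subseteq> W" using nbrs_subset[OF G] by (simp add: W_def)
    show "N x \<subseteq> W" for x
      using nbrs_subset[OF G, of v x] nbrs_subset[OF G, of d x] by (auto simp: N_def W_def)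
    show "x \<in> N y" if "y \<in> N x" for x y
      using that by (auto simp: N_def nbrs_def insert_commute)
  qed (use key nonempty in auto)
  then show False using deg[OF v d(1)] d cardW by auto
qed

lemma min_codegree_le_half_if_not_covered:
  assumes G: "three_graph G" and n: "2 \<le> card (verts G)" and nc: "\<not> has_covering C5 G"
  shows "min_codegree G \<le> card (verts G) div 2"
proof (rule ccontr)
  assume "\<not> ?thesis"
  then have big: "card (verts G) + 1 \<le> 2 * min_codegree G" by linarith
  have "card (verts G) + 1 \<le> 2 * codegree G x y"
    if "x \<in> verts G" "y \<in> verts G" "x \<noteq> y" for x y
    using min_codegree_le[OF G that] big by linarith
  then show False
    using C5_cover_if_large_codegree[OF G _ n] nc unfolding has_covering_def by blast
qed

section \<open>The lower bound\<close>

text \<open>The vertex 0 plays the role of the uncovered vertex; one equivalence describes both kinds of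
  edges, because a triple through 0 must, and a triple avoiding 0 must not, have its nonzero part
  inside one block.\<close>

definition two_block_graph :: "nat \<Rightarrow> nat set \<Rightarrow> nat set \<Rightarrow> nat hypergraph" where
  "two_block_graph n A B =
     ({..<n}, {e. e \<subseteq> {..<n} \<and> card e = 3 \<and> (0 \<in> e \<longleftrightarrow> e - {0} \<subseteq> A \<or> e - {0} \<subseteq> B)})"

text \<open>The codegree is smallest for 0 paired with a vertex of the smaller block: the remaining vertices
  of that block. Two vertices of one block are joined to the whole other block, and vertices
  of different blocks to everything but 0.\<close>

lemma exists_uncovered_large_codegree:
  assumes n: "5 \<le> n"
  shows "\<exists>G :: nat hypergraph. three_graph G \<and> card (verts G) = n \<and> \<not> has_covering C5 G \<and>
           (n - 1) div 2 - 1 \<le> min_codegree G"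
proof -
  define m where "m = (n - 1) div 2"
  define A where "A = {1..m}"
  define B where "B = {Suc m..<n}"
  define G where "G = two_block_graph n A B"
  have m: "2 \<le> m" "2 * m + 1 \<le> n" using n by (auto simp: m_def)
  have V: "verts G = {..<n}" by (simp add: G_def two_block_graph_def)
  have E: "e \<in> edges G \<longleftrightarrow>
      e \<subseteq> {..<n} \<and> card e = 3 \<and> (0 \<in> e \<longleftrightarrow> e - {0} \<subseteq> A \<or> e - {0} \<subseteq> B)" for e
    by (simp add: G_def two_block_graph_def)
  have G: "three_graph G" unfolding three_graph_def using V E by auto
  have inV: "x \<noteq> 0 \<and> x < n" if "x \<in> A \<or> x \<in> B" for x
    using that m by (auto simp: A_def B_def)
  have disj: "\<not> (x \<in> A \<and> x \<in> B)" for x by (simp add: A_def B_def)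
  have cover: "x = 0 \<or> x \<in> A \<or> x \<in> B" if "x < n" for x
    using that by (auto simp: A_def B_def)
  have fin: "finite A" "finite B" by (auto simp: A_def B_def)
  have cards: "m \<le> card A" "m \<le> card B" using m by (auto simp: A_def B_def)
  have edge0: "{0, x, y} \<in> edges G" if "x \<noteq> y" "x \<in> A \<and> y \<in> A \<or> x \<in> B \<and> y \<in> B" for x y
  proof -
    have "{0, x, y} \<subseteq> {..<n}" "x \<noteq> 0" "y \<noteq> 0" using that inV n by auto
    moreover have "{0, x, y} - {0} \<subseteq> A \<or> {0, x, y} - {0} \<subseteq> B" using that by blast
    ultimately show ?thesis unfolding E using that(1) by simp
  qed
  have edge1: "{x, y, z} \<in> edges G" if "x \<noteq> y" "x \<in> A \<and> y \<in> A \<and> z \<in> B \<or> x \<in> B \<and> y \<in> B \<and> z \<in> A"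
    for x y z
  proof -
    have nz: "{x, y, z} \<subseteq> {..<n}" "x \<noteq> 0" "y \<noteq> 0" "z \<noteq> 0" using that inV by auto
    have "x \<noteq> z" "y \<noteq> z" using that disj by blast+
    moreover have "\<not> {x, y, z} \<subseteq> A" "\<not> {x, y, z} \<subseteq> B" using that disj by blast+
    moreover have "{x, y, z} - {0} = {x, y, z}" using nz by blast
    ultimately show ?thesis unfolding E using that(1) nz by simp
  qed
  have minusA: "m - 1 \<le> card (A - {y})" and minusB: "m - 1 \<le> card (B - {y})" for y
    using cards fin by (auto simp: card_Diff_singleton_if)
  have large: "m - 1 \<le> card (nbrs G x y)" if "m - 1 \<le> card T" "T \<subseteq> nbrs G x y" for T x y
    using card_mono[OF finite_nbrs[OF G] that(2)] that(1) by linarith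
  have ord: "m - 1 \<le> card (nbrs G x y)"
    if neq: "x \<noteq> y"
      and sides: "x = 0 \<and> (y \<in> A \<or> y \<in> B) \<or> x \<in> A \<and> (y \<in> A \<or> y \<in> B) \<or> x \<in> B \<and> y \<in> B" for x y
  proof -
    consider "x = 0" "y \<in> A" | "x = 0" "y \<in> B" | "x \<in> A" "y \<in> A" | "x \<in> A" "y \<in> B" | "x \<in> B" "y \<in> B"
      using sides by blast
    then show ?thesis
    proof cases
      case 1
      show ?thesis
        by (rule large[OF minusA[of y]]) (use 1 edge0 in \<open>auto simp: nbrs_def\<close>)
    next
      case 2
      show ?thesis
        by (rule large[OF minusB[of y]]) (use 2 edge0 in \<open>auto simp: nbrs_def\<close>)
    next
      case 3
      show ?thesis
        by (rule large[of B]) (use 3 neq cards edge1 in \<open>auto simp: nbrs_def\<close>)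
    next
      case 4
      have "{x, y, z} \<in> edges G" if "z \<in> A - {x}" for z
        using edge1[of x z y] that 4 by (auto simp: insert_commute)
      then show ?thesis
        by (intro large[OF minusA[of x]]) (auto simp: nbrs_def)
    next
      case 5
      show ?thesis
        by (rule large[of A]) (use 5 neq cards edge1 in \<open>auto simp: nbrs_def\<close>)
    qed
  qed
  have "m - 1 \<le> min_codegree G"
  proof (rule le_min_codegree[OF G])
    show "2 \<le> card (verts G)" using n V by simp
    fix x y assume xy: "x \<in> verts G" "y \<in> verts G" "x \<noteq> y"
    then have "x = 0 \<or> x \<in> A \<or> x \<in> B" "y = 0 \<or> y \<in> A \<or> y \<in> B" using V cover by auto
    then have "m - 1 \<le> card (nbrs G x y)"
      using ord[OF xy(3)] ord[OF xy(3)[symmetric]] xy(3) unfolding nbrs_commute[of G y x] by blast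
    then show "m - 1 \<le> codegree G x y" using codegree_eq_card_nbrs[OF G xy(3)] by simp
  qed
  moreover have "\<not> has_covering C5 G"
  proof
    assume "has_covering C5 G"
    then have "\<exists>H. is_copy C5 G H \<and> 0 \<in> verts H" using V n by (auto simp: has_covering_def)
    then obtain a b c d where p: "{0, a, b} \<in> edges G" "{0, b, c} \<in> edges G"
        "{0, c, d} \<in> edges G" and e: "{d, a, b} \<in> edges G"
      unfolding C5_cover_iff[OF G] by blast
    note dist = p[THEN edge_distinct(1)[OF G]] p[THEN edge_distinct(2)[OF G]]
    have same: "x \<in> A \<and> y \<in> A \<or> x \<in> B \<and> y \<in> B" if "{0, x, y} \<in> edges G" for x y
    proof -
      have "{0, x, y} - {0} = {x, y}" using edge_distinct[OF G that] by blast
      then show ?thesis using that unfolding E by simp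
    qed
    have "{d, a, b} \<subseteq> A \<or> {d, a, b} \<subseteq> B"
      using p[THEN same] disj by blast
    moreover have "{d, a, b} - {0} = {d, a, b}" "0 \<notin> {d, a, b}" using dist by auto
    ultimately show False using e unfolding E by simp
  qed
  moreover have "card (verts G) = n" using V by simp
  ultimately show ?thesis using G unfolding m_def by blast
qed

section \<open>The covering threshold\<close>

text \<open>The upper bound also shows that the set defining \<open>c2\<close> is finite, and the construction that it
  is nonempty; only then is its \<open>Max\<close> an actual maximum.\<close>

lemma c2_C5_bounds:
  assumes n: "5 \<le> n"
  shows "(n - 1) div 2 - 1 \<le> c2 n C5" "c2 n C5 \<le> n div 2"
proof -
  let ?M = "{min_codegree G | G :: nat hypergraph.
    three_graph G \<and> card (verts G) = n \<and> \<not> has_covering C5 G}"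
  have ub: "k \<le> n div 2" if "k \<in> ?M" for k
    using that n min_codegree_le_half_if_not_covered by fastforce
  have fin: "finite ?M" using ub finite_nat_set_iff_bounded_le by blast
  obtain k where k: "k \<in> ?M" "(n - 1) div 2 - 1 \<le> k"
    using exists_uncovered_large_codegree[OF n] by blast
  show "(n - 1) div 2 - 1 \<le> c2 n C5"
    unfolding c2_def using k Max_ge[OF fin k(1)] by linarith
  show "c2 n C5 \<le> n div 2"
    unfolding c2_def using Max_in[OF fin] k(1) ub by blast
qed

lemma c2_ratio_C5_tendsto: "c2_ratio C5 \<longlonglongrightarrow> 1 / 2"
proof (rule tendsto_sandwich)
  show "\<forall>\<^sub>F n in sequentially. ((real n - 4) / 2) / (real n - 2) \<le> c2_ratio C5 n"
    using eventually_ge_at_top[of 5]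
  proof eventually_elim
    case (elim n)
    have "n \<le> 2 * c2 n C5 + 4" using c2_C5_bounds(1)[OF elim] by linarith
    then have "real n \<le> real (2 * c2 n C5 + 4)" by (simp only: of_nat_le_iff)
    then have "(real n - 4) / 2 \<le> real (c2 n C5)" by simp
    then show ?case unfolding c2_ratio_def using elim by (intro divide_right_mono) auto
  qed
  show "\<forall>\<^sub>F n in sequentially. c2_ratio C5 n \<le> (real n / 2) / (real n - 2)"
    using eventually_ge_at_top[of 5]
  proof eventually_elim
    case (elim n)
    have "2 * c2 n C5 \<le> n" using c2_C5_bounds(2)[OF elim] by linarith
    then have "real (c2 n C5) \<le> real n / 2" by linarith
    then show ?case unfolding c2_ratio_def using elim by (intro divide_right_mono) auto
  qed
  show "(\<lambda>n. ((real n - 4) / 2) / (real n - 2)) \<longlonglongrightarrow> 1 / 2" by real_asymp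
  show "(\<lambda>n. (real n / 2) / (real n - 2)) \<longlonglongrightarrow> 1 / 2" by real_asymp
qed

theorem theorem1p3:
  shows "(\<forall>n::nat. n \<ge> 5 \<longrightarrow>
            \<lfloor>(real n - 3) / 2\<rfloor> \<le> int (c2 n C5) \<and> int (c2 n C5) \<le> \<lfloor>real n / 2\<rfloor>) \<and>
         convergent (c2_ratio C5) \<and> c2_lim C5 = 1 / 2"
proof (intro conjI allI impI)
  fix n :: nat assume n: "n \<ge> 5"
  have "n \<le> 2 * c2 n C5 + 4" using c2_C5_bounds(1)[OF n] by linarith
  then have "real n \<le> real (2 * c2 n C5 + 4)" by (simp only: of_nat_le_iff)
  then have "(real n - 3) / 2 < real_of_int (int (c2 n C5)) + 1" by simp
  then show "\<lfloor>(real n - 3) / 2\<rfloor> \<le> int (c2 n C5)" by (simp add: floor_le_iff)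
  have "2 * c2 n C5 \<le> n" using c2_C5_bounds(2)[OF n] by linarith
  then show "int (c2 n C5) \<le> \<lfloor>real n / 2\<rfloor>" by linarith
next
  show "convergent (c2_ratio C5)" using c2_ratio_C5_tendsto by (rule convergentI)
  show "c2_lim C5 = 1 / 2" unfolding c2_lim_def using c2_ratio_C5_tendsto by (rule limI)
qed

end
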